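(* Let $\mathcal{D}$ be the Dirichlet space on the open unit disk $\mathbb{D}$, let $g_1,\dots,g_n,h_1,\dots,h_n\in\mathcal{D}$ be of the form $g_j(z)=\sum_{m=1}^{\infty}a_{j,m}z^m$ and $h_j(z)=\sum_{m=1}^{\infty}b_{j,m}z^m$, and let $T$ be the finite rank operator on $\mathcal{D}$ given by $T(f)=\sum_{j=1}^n\langle f,g_j\rangle h_j$ for $f\in\mathcal{D}$. If all the coefficients $a_{j,m}$ and $b_{j,m}$ of the $g_j$ and $h_j$ are real, then $\mathbf{Ber}(T)$ is symmetric about the real axis.
   Context: $\mathbb{D}=\{z\in\mathbb{C}:|z|<1\}$. The Dirichlet space $\mathcal{D}$ consists of all holomorphic $f$ on $\mathbb{D}$ with $\frac1\pi\int_{\mathbb{D}}|f'(z)|^2\,dA(z)<\infty$ ($dA$ = area Lebesgue measure), with inner product $\langle f,g\rangle=\langle f,g\rangle_{H^2(\mathbb{D})}+\frac1\pi\int_{\mathbb{D}}f'(z)\overline{g'(z)}\,dA(z)$, where $\langle\sum a_nz^n,\sum b_nz^n\rangle_{H^2(\mathbb{D})}=\sum a_n\overline{b_n}$. It is a reproducing kernel Hilbert space on $\mathbb{D}$ with kernel $k_w(z)=\frac{1}{z\overline w}\log\big(\frac{1}{1-z\overline w}\big)$ for $w\in\mathbb{D}\setminus\{0\}$ (value $1$ at $z=0$) and $k_0=1$. With $\hat k_\lambda=k_\lambda/\|k_\lambda\|$, the Berezin range of a bounded operator $T$ on $\mathcal{D}$ is $\mathbf{Ber}(T)=\{\langle T\hat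 k_\lambda,\hat k_\lambda\rangle:\lambda\in\mathbb{D}\}$. A set $E\subseteq\mathbb{C}$ is symmetric about the real axis if $z\in E$ implies $\overline z\in E$. *)

theory Defs
  imports "HOL-Complex_Analysis.Complex_Analysis"
begin

text \<open>Functions on the open unit disk are total functions on \<^typ>\<open>complex\<close>; every notion below
  depends only on their values on \<^term>\<open>ball 0 1 :: complex set\<close>.\<close>

definition dirichlet_space :: "(complex \<Rightarrow> complex) set" where
  "dirichlet_space =
     {f. f holomorphic_on ball 0 1 \<and>
         set_integrable lborel (ball 0 1) (\<lambda>z. (cmod (deriv f z))\<^sup>2)}"

definition taylor_coeff :: "(complex \<Rightarrow> complex) \<Rightarrow> nat \<Rightarrow> complex" where
  "taylor_coeff f m = (deriv ^^ m) f 0 / fact m"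

definition hardy_inner :: "(complex \<Rightarrow> complex) \<Rightarrow> (complex \<Rightarrow> complex) \<Rightarrow> complex" where
  "hardy_inner f g = (\<Sum>\<^sub>\<infinity>m. taylor_coeff f m * cnj (taylor_coeff g m))"

definition dirichlet_inner :: "(complex \<Rightarrow> complex) \<Rightarrow> (complex \<Rightarrow> complex) \<Rightarrow> complex" where
  "dirichlet_inner f g =
     hardy_inner f g +
     1 / of_real pi * (LINT z:ball 0 1|lborel. deriv f z * cnj (deriv g z))"

definition dirichlet_norm :: "(complex \<Rightarrow> complex) \<Rightarrow> real" where
  "dirichlet_norm f = sqrt (Re (dirichlet_inner f f))"

text \<open>For \<^term>\<open>z\<close> and \<^term>\<open>w\<close> in the unit disk, \<^term>\<open>1 - z * cnj w\<close> has positive real part, so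
  the principal branch \<^const>\<open>Ln\<close> is the one with value 0 at 1.\<close>

definition dirichlet_kernel :: "complex \<Rightarrow> complex \<Rightarrow> complex" where
  "dirichlet_kernel w z =
     (if w = 0 \<or> z = 0 then 1
      else 1 / (z * cnj w) * Ln (1 / (1 - z * cnj w)))"

definition normalized_kernel :: "complex \<Rightarrow> complex \<Rightarrow> complex" where
  "normalized_kernel w z = dirichlet_kernel w z / of_real (dirichlet_norm (dirichlet_kernel w))"

definition berezin_range :: "((complex \<Rightarrow> complex) \<Rightarrow> (complex \<Rightarrow> complex)) \<Rightarrow> complex set" where
  "berezin_range T =
     {dirichlet_inner (T (normalized_kernel w)) (normalized_kernel w) | w. w \<in> ball 0 1}"

definition symmetric_about_real_axis :: "complex set \<Rightarrow> bool" where
  "symmetric_about_real_axis E \<longleftrightarrow> (\<forall>z\<in>E. cnj z \<in> E)"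

end

(* Conjugation of the disk, f |-> cnj o f o cnj, preserves the Dirichlet inner product up to complex
   conjugation, it maps k_w to k_(cnj w), and it fixes power series with real coefficients. Hence
   <T k_w, k_w> at cnj w is the conjugate of its value at w. *)

theory Submission
  imports Defs
begin

text \<open>A relation rather than the map sending \<open>f\<close> to \<open>cnj o f o cnj\<close>:
  operators and kernels are controlled only on the disk, so \<open>f'\<close> may take any values
  outside it. The holomorphy of \<open>f'\<close> on the disk follows from that of
  \<open>f\<close>.\<close>

definition reflected :: "(complex \<Rightarrow> complex) \<Rightarrow> (complex \<Rightarrow> complex) \<Rightarrow> bool" where
  "reflected f f' \<longleftrightarrow> f holomorphic_on ball 0 1 \<and> (\<forall>z\<in>ball 0 1. f' z = cnj (f (cnj z)))"

lemma deriv_reflected: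
  assumes "reflected f f'" "z \<in> ball 0 1"
  shows "(f' has_field_derivative cnj (deriv f (cnj z))) (at z)"
proof -
  have "cnj z \<in> ball 0 1"
    using assms(2) by simp
  then have "(f has_field_derivative deriv f (cnj z)) (at (cnj z))"
    using assms(1) holomorphic_derivI[of f "ball 0 1" "cnj z"] by (auto simp: reflected_def)
  then have "(cnj \<circ> f \<circ> cnj has_field_derivative cnj (deriv f (cnj z))) (at z)"
    by (rule has_field_derivative_cnj_cnj)
  \<comment> \<open>\<open>f'\<close> agrees with \<open>cnj o f o cnj\<close> only on the disk,
    which is enough because the disk is open.\<close>
  then show ?thesis
    by (rule has_field_derivative_transform_within_open[where S = "ball 0 1"])
      (use assms in \<open>auto simp: reflected_def\<close>)
qed

lemma reflected_deriv:
  assumes "reflected f f'"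
  shows "reflected (deriv f) (deriv f')"
  using assms deriv_reflected[OF assms] holomorphic_deriv[of f "ball 0 1"]
  by (auto simp: reflected_def intro!: DERIV_imp_deriv)

lemma reflected_higher_deriv:
  assumes "reflected f f'"
  shows "reflected ((deriv ^^ m) f) ((deriv ^^ m) f')"
  by (induction m) (use assms in \<open>auto intro: reflected_deriv\<close>)

lemma taylor_coeff_reflected:
  assumes "reflected f f'"
  shows "taylor_coeff f' m = cnj (taylor_coeff f m)"
  using reflected_higher_deriv[OF assms, of m] by (simp add: taylor_coeff_def reflected_def)

lemma hardy_inner_reflected:
  assumes "reflected f f'" "reflected g g'"
  shows "hardy_inner f' g' = cnj (hardy_inner f g)"
proof -
  have "hardy_inner f' g' = (\<Sum>\<^sub>\<infinity>m. cnj (taylor_coeff f m * cnj (taylor_coeff g m)))"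
    by (simp add: hardy_inner_def taylor_coeff_reflected[OF assms(1)]
        taylor_coeff_reflected[OF assms(2)])
  \<comment> \<open>Conjugation passes through the sum in all cases: it preserves summability, and
    the default value 0 of a divergent sum is real.\<close>
  then show ?thesis
    by (simp only: hardy_inner_def infsum_cnj)
qed

text \<open>Conjugation is a diagonal real linear map whose Jacobian has absolute value 1.\<close>

lemma distr_lborel_cnj: "distr lborel borel cnj = (lborel :: complex measure)"
proof -
  \<comment> \<open>The scaling factors of conjugation along the basis vectors 1 and i.\<close>
  define c where "c = (\<lambda>j::complex. if j = 1 then 1 else -1 :: real)"
  have c: "c 1 = 1" "c \<i> = -1"
    by (auto simp: c_def)
  have eq: "(\<lambda>x. 0 + (\<Sum>j\<in>Basis. (c j * (x \<bullet> j)) *\<^sub>R j)) = cnj"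
    by (simp add: fun_eq_iff Basis_complex_def c complex_eq_iff)
  have "(lborel :: complex measure) = density (distr lborel borel cnj) (\<lambda>_. \<Prod>j\<in>Basis. \<bar>c j\<bar>)"
    using lborel_affine_euclidean[of c 0] unfolding eq by (simp add: c_def)
  then show ?thesis
    by (simp add: Basis_complex_def c density_1)
qed

text \<open>The area integral is treated by the substitution of \<open>cnj z\<close> for
  \<open>z\<close>, which preserves both the disk and Lebesgue measure.\<close>

lemma dirichlet_inner_reflected:
  assumes "reflected f f'" "reflected g g'"
  shows "dirichlet_inner f' g' = cnj (dirichlet_inner f g)"
proof -
  \<comment> \<open>The indicator is part of \<open>F\<close> because \<open>deriv f\<close> and
    \<open>deriv g\<close> are known to be continuous only on the disk, whereas the change of
    variables asks for measurability on the whole plane.\<close>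
  define F where "F = (\<lambda>z. indicator (ball 0 1) z *\<^sub>R (deriv f z * cnj (deriv g z)))"
  have "continuous_on (ball 0 1) (deriv f)" "continuous_on (ball 0 1) (deriv g)"
    using reflected_deriv[OF assms(1)] reflected_deriv[OF assms(2)]
    by (auto simp: reflected_def holomorphic_on_imp_continuous_on)
  then have meas: "F \<in> borel_measurable borel"
    unfolding F_def by (intro borel_measurable_continuous_on_indicator continuous_intros) auto
  have "(LINT z:ball 0 1|lborel. deriv f' z * cnj (deriv g' z)) = (LINT z|lborel. cnj (F (cnj z)))"
    unfolding set_lebesgue_integral_def
    by (rule Bochner_Integration.integral_cong)
      (use reflected_deriv[OF assms(1)] reflected_deriv[OF assms(2)] in
        \<open>auto simp: F_def reflected_def indicator_def\<close>)
  also have "\<dots> = cnj (LINT z|lborel. F (cnj z))"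
    by simp
  also have "(LINT z|lborel. F (cnj z)) = (LINT z|distr lborel borel cnj. F z)"
    by (rule integral_distr[symmetric])
      (use meas in \<open>auto intro!: borel_measurable_continuous_onI continuous_intros\<close>)
  also have "\<dots> = (LINT z:ball 0 1|lborel. deriv f z * cnj (deriv g z))"
    by (simp only: distr_lborel_cnj F_def set_lebesgue_integral_def)
  finally show ?thesis
    by (simp add: dirichlet_inner_def hardy_inner_reflected[OF assms])
qed

text \<open>The derivative is continuous on the compact closed disk, so its squared modulus is
  integrable there.\<close>

lemma dirichlet_space_holomorphic_nbhd:
  assumes "f holomorphic_on U" "open U" "cball 0 1 \<subseteq> U"
  shows "f \<in> dirichlet_space"
proof -
  have "continuous_on (cball 0 1) (\<lambda>z. (cmod (deriv f z))\<^sup>2)"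
    by (intro continuous_intros continuous_on_subset[OF holomorphic_on_imp_continuous_on])
      (use assms in \<open>auto intro: holomorphic_deriv\<close>)
  then have "set_integrable lborel (cball 0 1) (\<lambda>z. (cmod (deriv f z))\<^sup>2)"
    unfolding set_integrable_def by (intro borel_integrable_compact) auto
  then have "set_integrable lborel (ball 0 1) (\<lambda>z. (cmod (deriv f z))\<^sup>2)"
    by (rule set_integrable_subset) auto
  moreover have "f holomorphic_on ball 0 1"
    using assms(1,3) ball_subset_cball by (meson holomorphic_on_subset order_trans)
  ultimately show ?thesis
    by (simp add: dirichlet_space_def)
qed

text \<open>Since \<open>1 - u\<close> has positive real part, so has its inverse. This keeps the
  argument of \<open>Ln\<close> off the branch cut, where \<open>Ln\<close> is holomorphic and
  commutes with conjugation.\<close>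

lemma one_minus_inverse_notin_nonpos_Reals:
  fixes u :: complex
  assumes "norm u < 1"
  shows "1 / (1 - u) \<notin> \<real>\<^sub>\<le>\<^sub>0"
proof
  assume "1 / (1 - u) \<in> \<real>\<^sub>\<le>\<^sub>0"
  then obtain r where r: "r \<le> 0" "1 / (1 - u) = complex_of_real r"
    by (elim nonpos_Reals_cases)
  have "u \<noteq> 1"
    using assms by auto
  then have "1 = of_real r * (1 - u)"
    using r(2) by (simp add: field_simps)
  then have "1 = Re (of_real r * (1 - u))"
    by (metis one_complex.sel(1))
  then have "1 = r * (1 - Re u)"
    by simp
  moreover have "Re u < 1"
    using assms complex_Re_le_cmod[of u] by linarith
  ultimately show False
    using r(1) mult_nonpos_nonneg[of r "1 - Re u"] by linarith
qed

text \<open>Every kernel is this one function evaluated at \<open>z * cnj w\<close>. Its singularity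
  at 0 is removable: it is the difference quotient at 0 of the logarithm, whose value there is 0 and
  whose derivative is 1.\<close>

lemma kernel_profile_holomorphic:
  "(\<lambda>u. if u = 0 then 1 else 1 / u * Ln (1 / (1 - u))) holomorphic_on ball 0 1"
proof -
  let ?f = "\<lambda>u::complex. Ln (1 / (1 - u))"
  have "?f holomorphic_on ball 0 1"
    using one_minus_inverse_notin_nonpos_Reals by (intro holomorphic_intros) auto
  then have "(\<lambda>u. if u = 0 then deriv ?f 0 else (?f u - ?f 0) / (u - 0)) holomorphic_on ball 0 1"
    by (rule pole_lemma_open) auto
  then show ?thesis
  proof (rule holomorphic_transform)
    have "(?f has_field_derivative 1) (at 0)"
      by (auto intro!: derivative_eq_intros)
    then have "deriv ?f 0 = 1"
      by (rule DERIV_imp_deriv)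
    then show "(if u = 0 then deriv ?f 0 else (?f u - ?f 0) / (u - 0)) =
        (if u = 0 then 1 else 1 / u * Ln (1 / (1 - u)))" for u
      by simp
  qed
qed

text \<open>For \<open>w\<close> in the unit disk this domain is an open neighbourhood of the closed
  disk, which yields membership in \<open>dirichlet_space\<close>.\<close>

lemma dirichlet_kernel_holomorphic:
  "dirichlet_kernel w holomorphic_on {z. norm (z * cnj w) < 1}"
proof -
  have "(\<lambda>u. if u = 0 then 1 else 1 / u * Ln (1 / (1 - u))) \<circ> (\<lambda>z. z * cnj w)
      holomorphic_on {z. norm (z * cnj w) < 1}"
    by (intro holomorphic_on_compose_gen[OF _ kernel_profile_holomorphic] holomorphic_intros) auto
  then show ?thesis
    by (rule holomorphic_transform) (auto simp: dirichlet_kernel_def)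
qed

lemma normalized_kernel_dirichlet_space:
  assumes "w \<in> ball 0 1"
  shows "normalized_kernel w \<in> dirichlet_space"
proof (rule dirichlet_space_holomorphic_nbhd)
  show "normalized_kernel w holomorphic_on {z. norm (z * cnj w) < 1}"
    \<comment> \<open>Multiplication by the constant inverse of the norm keeps holomorphy whatever
      the value of the norm, with \<open>inverse 0 = 0\<close> included.\<close>
    using dirichlet_kernel_holomorphic[of w] unfolding normalized_kernel_def divide_inverse
    by (intro holomorphic_intros)
  show "open {z. norm (z * cnj w) < 1}"
    by (intro open_Collect_less continuous_intros)
  have "norm (z * cnj w) < 1" if "norm z \<le> 1" for z
    using assms that mult_left_le_one_le[of "norm w" "norm z"] by (auto simp: norm_mult)
  then show "cball 0 1 \<subseteq> {z. norm (z * cnj w) < 1}"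
    by auto
qed

lemma dirichlet_kernel_reflected:
  assumes "w \<in> ball 0 1"
  shows "reflected (dirichlet_kernel w) (dirichlet_kernel (cnj w))"
  unfolding reflected_def
proof (intro conjI ballI)
  have lt: "norm (z * cnj w) < 1" if "norm z < 1" for z
    using assms that mult_left_le_one_le[of "norm w" "norm z"] by (auto simp: norm_mult)
  then show "dirichlet_kernel w holomorphic_on ball 0 1"
    by (intro holomorphic_on_subset[OF dirichlet_kernel_holomorphic]) auto
  fix z :: complex
  assume "z \<in> ball 0 1"
  then have "norm (cnj z * cnj w) < 1"
    by (intro lt) auto
  then show "dirichlet_kernel (cnj w) z = cnj (dirichlet_kernel w (cnj z))"
    using one_minus_inverse_notin_nonpos_Reals by (simp add: dirichlet_kernel_def cnj_Ln)
qed

lemma normalized_kernel_reflected: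
  assumes "w \<in> ball 0 1"
  shows "reflected (normalized_kernel w) (normalized_kernel (cnj w))"
proof -
  note k = dirichlet_kernel_reflected[OF assms]
  \<comment> \<open>The two squared norms are real parts of conjugate numbers, so both kernels are
    divided by the same real constant.\<close>
  have norm: "dirichlet_norm (dirichlet_kernel (cnj w)) = dirichlet_norm (dirichlet_kernel w)"
    by (simp add: dirichlet_norm_def dirichlet_inner_reflected[OF k k])
  have "normalized_kernel w holomorphic_on ball 0 1"
    using normalized_kernel_dirichlet_space[OF assms] by (simp add: dirichlet_space_def)
  then show ?thesis
    using k by (simp add: reflected_def normalized_kernel_def norm)
qed

text \<open>Conjugating the series at \<open>cnj z\<close> gives back the series at
  \<open>z\<close>, and a series has only one sum. The index \<open>Suc m\<close> reflects the
  absence of a constant term; \<open>c 0\<close> is unconstrained.\<close>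

lemma reflected_self_real_coeffs:
  assumes "f holomorphic_on ball 0 1"
    and "\<And>z. z \<in> ball 0 1 \<Longrightarrow> (\<lambda>m. c (Suc m) * z ^ Suc m) sums f z"
    and "\<And>m. m \<ge> 1 \<Longrightarrow> c m \<in> \<real>"
  shows "reflected f f"
  unfolding reflected_def
proof (intro conjI ballI assms(1))
  fix z :: complex
  assume z: "z \<in> ball 0 1"
  then have "(\<lambda>m. c (Suc m) * cnj z ^ Suc m) sums f (cnj z)"
    by (intro assms(2)) auto
  then have "(\<lambda>m. cnj (c (Suc m) * cnj z ^ Suc m)) sums cnj (f (cnj z))"
    by (simp only: sums_cnj)
  moreover have "cnj (c (Suc m) * cnj z ^ Suc m) = c (Suc m) * z ^ Suc m" for m
    using assms(3)[of "Suc m"] by (simp add: Reals_cnj_iff)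
  ultimately have "(\<lambda>m. c (Suc m) * z ^ Suc m) sums cnj (f (cnj z))"
    by (simp only:)
  then show "f z = cnj (f (cnj z))"
    using assms(2)[OF z] by (rule sums_unique2[rotated])
qed

theorem theorem5p2:
  fixes n :: nat
    and g h :: "nat \<Rightarrow> complex \<Rightarrow> complex"
    and a b :: "nat \<Rightarrow> nat \<Rightarrow> complex"
    and T :: "(complex \<Rightarrow> complex) \<Rightarrow> (complex \<Rightarrow> complex)"
  assumes "\<And>j. j \<in> {1..n} \<Longrightarrow> g j \<in> dirichlet_space"
    and "\<And>j. j \<in> {1..n} \<Longrightarrow> h j \<in> dirichlet_space"
    and "\<And>j z. j \<in> {1..n} \<Longrightarrow> z \<in> ball 0 1 \<Longrightarrow> (\<lambda>m. a j (Suc m) * z ^ Suc m) sums g j z"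
    and "\<And>j z. j \<in> {1..n} \<Longrightarrow> z \<in> ball 0 1 \<Longrightarrow> (\<lambda>m. b j (Suc m) * z ^ Suc m) sums h j z"
    and "\<And>f z. f \<in> dirichlet_space \<Longrightarrow> z \<in> ball 0 1 \<Longrightarrow>
           T f z = (\<Sum>j=1..n. dirichlet_inner f (g j) * h j z)"
    and "\<And>j m. j \<in> {1..n} \<Longrightarrow> m \<ge> 1 \<Longrightarrow> a j m \<in> \<real>"
    and "\<And>j m. j \<in> {1..n} \<Longrightarrow> m \<ge> 1 \<Longrightarrow> b j m \<in> \<real>"
  shows "symmetric_about_real_axis (berezin_range T)"
proof -
  note T = assms(5)
  have g: "reflected (g j) (g j)" if "j \<in> {1..n}" for j
    using that assms(1)[OF that] assms(3,6)
    by (intro reflected_self_real_coeffs[where c = "a j"]) (auto simp: dirichlet_space_def)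
  have h: "reflected (h j) (h j)" if "j \<in> {1..n}" for j
    using that assms(2)[OF that] assms(4,7)
    by (intro reflected_self_real_coeffs[where c = "b j"]) (auto simp: dirichlet_space_def)
  have "dirichlet_inner (T (normalized_kernel (cnj w))) (normalized_kernel (cnj w)) =
      cnj (dirichlet_inner (T (normalized_kernel w)) (normalized_kernel w))"
    if w: "w \<in> ball 0 1" for w
  \<comment> \<open>It remains to see that the kernels at \<open>w\<close> and \<open>cnj w\<close>
    are reflections of each other, and that \<open>T\<close> carries them to functions related in
    the same way.\<close>
  proof (rule dirichlet_inner_reflected)
    let ?k = "normalized_kernel w" and ?k' = "normalized_kernel (cnj w)"
    show k: "reflected ?k ?k'"
      using w by (rule normalized_kernel_reflected)
    \<comment> \<open>The formula for \<open>T\<close> is available only on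
      \<open>dirichlet_space\<close>, so both kernels have to lie in it.\<close>
    have D: "?k \<in> dirichlet_space" "?k' \<in> dirichlet_space"
      using w by (auto intro!: normalized_kernel_dirichlet_space)
    have "(\<lambda>z. \<Sum>j=1..n. dirichlet_inner ?k (g j) * h j z) holomorphic_on ball 0 1"
      using h by (intro holomorphic_intros) (auto simp: reflected_def)
    then have "T ?k holomorphic_on ball 0 1"
      by (rule holomorphic_transform) (simp add: T D)
    moreover have "T ?k' z = cnj (T ?k (cnj z))" if z: "z \<in> ball 0 1" for z
    proof -
      have "cnj z \<in> ball 0 1"
        using z by simp
      then have "cnj (T ?k (cnj z)) =
          (\<Sum>j=1..n. cnj (dirichlet_inner ?k (g j)) * cnj (h j (cnj z)))"
        by (simp add: T D)
      \<comment> \<open>Each \<open>g j\<close> and each \<open>h j\<close> is its own reflection,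
        so conjugating a summand only replaces the kernel at \<open>w\<close> by the one at
        \<open>cnj w\<close>.\<close>
      also have "\<dots> = (\<Sum>j=1..n. dirichlet_inner ?k' (g j) * h j z)"
      proof (intro sum.cong refl)
        fix j
        assume j: "j \<in> {1..n}"
        have "cnj (h j (cnj z)) = h j z"
          using h[OF j] z unfolding reflected_def by metis
        then show "cnj (dirichlet_inner ?k (g j)) * cnj (h j (cnj z)) =
            dirichlet_inner ?k' (g j) * h j z"
          by (simp only: dirichlet_inner_reflected[OF k g[OF j]])
      qed
      also have "\<dots> = T ?k' z"
        using z by (simp add: T D)
      finally show ?thesis
        by simp
    qed
    ultimately show "reflected (T ?k) (T ?k')"
      by (simp add: reflected_def)
  qed
  \<comment> \<open>The conjugate of the value at \<open>w\<close> is attained at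
    \<open>cnj w\<close>, which has the same modulus and so lies in the disk.\<close>
  then show ?thesis
    unfolding symmetric_about_real_axis_def berezin_range_def
    by (clarsimp, metis complex_mod_cnj)
qed

end
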